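(* Let $\pi=UUD$ and, for $k\geqslant 0$, let $A_k(x)$ be the generating function, by semilength, of the Dyck paths $P\in\mathcal{D}^{h_\pi,\geqslant}$ with $h_\pi(P)=k$. Then the amplitude of $\pi$ is $r_\pi=2$, and $$A_2(x)=\frac{x^2}{(x-1)(x^2+x-1)},\qquad A_1(x)=0,\qquad A_0(x)=\frac{1}{1-x}.$$
   Context: A Dyck path is a lattice path starting at $(0,0)$, ending on the $x$-axis, never going below it, with steps $U=(1,1)$ and $D=(1,-1)$. A pattern is a factor of consecutive steps; the height of an occurrence is the maximal ordinate reached by its points; $h_\pi(P)$ is the maximal height of an occurrence of $\pi$ in $P$ ($0$ if $\pi$ does not occur). The amplitude $r_\pi$ is the height of $\pi$ viewed as a path in the quarter plane whose lowest point touches the $x$-axis. The set $\mathcal{D}^{h_\pi,\geqslant}$ consists of the empty path together with all Dyck paths $P$ whose first return decomposition $P=U\alpha D\beta$ satisfies $\alpha,\beta\in\mathcal{D}^{h_\pi,\geqslant}$ and $h_\pi(U\alpha D)\geqslant h_\pi(\beta)$ (with $h_\pi(U\alpha D)$ computed on the path $U\alpha D$ alone). *)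

theory Defs
  imports "HOL-Computational_Algebra.Formal_Power_Series"
begin

datatype step = U | D

fun rise :: "step \<Rightarrow> int" where
  "rise U = 1"
| "rise D = -1"

text \<open>The ordinates of all points of a path (both endpoints included) that starts at ordinate \<open>a\<close>.\<close>

fun ordinates :: "int \<Rightarrow> step list \<Rightarrow> int list" where
  "ordinates a [] = [a]"
| "ordinates a (s # p) = a # ordinates (a + rise s) p"

definition dyck_path :: "step list \<Rightarrow> bool" where
  "dyck_path P \<longleftrightarrow> (\<forall>y \<in> set (ordinates 0 P). 0 \<le> y) \<and> last (ordinates 0 P) = 0"

definition semilength :: "step list \<Rightarrow> nat" where
  "semilength P = length P div 2"

definition occurrence_heights :: "step list \<Rightarrow> step list \<Rightarrow> int set" where
  "occurrence_heights \<pi> P =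
     {Max (set (ordinates (last (ordinates 0 xs)) \<pi>)) | xs ys. P = xs @ \<pi> @ ys}"

definition pattern_height :: "step list \<Rightarrow> step list \<Rightarrow> int" where
  "pattern_height \<pi> P =
     (if occurrence_heights \<pi> P = {} then 0 else Max (occurrence_heights \<pi> P))"

text \<open>Starting \<open>\<pi>\<close> at minus its minimal relative ordinate puts its lowest point on the x-axis.\<close>

definition amplitude :: "step list \<Rightarrow> int" where
  "amplitude \<pi> = Max (set (ordinates (- Min (set (ordinates 0 \<pi>))) \<pi>))"

text \<open>As \<open>\<alpha>\<close> is itself a Dyck path, the displayed \<open>D\<close> is the first return to the x-axis.\<close>

definition first_return_decomp :: "step list \<Rightarrow> step list \<Rightarrow> step list \<Rightarrow> bool" where
  "first_return_decomp P \<alpha> \<beta> \<longleftrightarrow> dyck_path \<alpha> \<and> dyck_path \<beta> \<and> P = [U] @ \<alpha> @ [D] @ \<beta>"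

inductive_set dyck_geq :: "step list \<Rightarrow> step list set" for \<pi> :: "step list" where
  empty: "[] \<in> dyck_geq \<pi>"
| decomp: "\<lbrakk>dyck_path P; first_return_decomp P \<alpha> \<beta>; \<alpha> \<in> dyck_geq \<pi>; \<beta> \<in> dyck_geq \<pi>;
     pattern_height \<pi> ([U] @ \<alpha> @ [D]) \<ge> pattern_height \<pi> \<beta>\<rbrakk> \<Longrightarrow> P \<in> dyck_geq \<pi>"

definition height_gf :: "step list \<Rightarrow> nat \<Rightarrow> rat fps" where
  "height_gf \<pi> k = Abs_fps (\<lambda>n. of_nat
     (card {P \<in> dyck_geq \<pi>. pattern_height \<pi> P = int k \<and> semilength P = n}))"

end

theory Submission
  imports Defs "HOL-Library.Disjoint_Sets" "HOL-Library.Sublist"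
begin

text \<open>If a pattern has no \<open>D\<close> before its last step, none of its occurrences straddles the end of
  a Dyck path, so the height of \<open>U\<alpha>D\<beta>\<close> is the maximum of those of \<open>U\<alpha>D\<close> and \<open>\<beta>\<close>. Hence the
  paths of height \<open>k\<close> in the class are the \<open>U\<alpha>D\<beta>\<close> with \<open>h(U\<alpha>D) = k \<ge> h(\<beta>)\<close>, and the empty path
  if \<open>k = 0\<close>. For \<open>UUD\<close>, \<open>h(U\<alpha>D) = 0\<close> means that \<open>\<alpha>\<close> is empty, and \<open>h(U\<alpha>D) = 2\<close> that
  \<open>\<alpha>\<close> is nonempty with \<open>h(\<alpha>) = 0\<close>. Counting by semilength, \<open>A\<^sub>0 = 1 + x A\<^sub>0\<close> and
  \<open>A\<^sub>2 = x (A\<^sub>0 - 1) (A\<^sub>0 + A\<^sub>1 + A\<^sub>2)\<close>, where \<open>A\<^sub>1 = 0\<close> because no occurrence in a Dyck path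
  is lower than the amplitude.\<close>

section \<open>Dyck paths\<close>

abbreviation net_rise :: "step list \<Rightarrow> int" where
  "net_rise xs \<equiv> sum_list (map rise xs)"

lemma ordinates_not_Nil [simp]: "ordinates a xs \<noteq> []"
  by (cases xs) auto

lemma last_ordinates: "last (ordinates a xs) = a + net_rise xs"
  by (induction xs arbitrary: a) auto

lemma set_ordinates_append:
  "set (ordinates a (xs @ ys)) = set (ordinates a xs) \<union> set (ordinates (a + net_rise xs) ys)"
proof (induction xs arbitrary: a)
  case Nil
  then show ?case by (cases ys) auto
qed (auto simp: add.assoc)

lemma set_ordinates_shift: "set (ordinates (a + b) xs) = (+) a ` set (ordinates b xs)"
  by (induction xs arbitrary: b) (auto simp: add.assoc)

lemma dyck_path_Nil [simp]: "dyck_path []"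
  by (simp add: dyck_path_def)

lemma net_rise_dyck_path: "dyck_path P \<Longrightarrow> net_rise P = 0"
  by (simp add: dyck_path_def last_ordinates)

lemma net_rise_prefix_nonneg:
  assumes "dyck_path (xs @ ys)"
  shows "net_rise xs \<ge> 0"
proof -
  have "last (ordinates 0 xs) \<in> set (ordinates 0 xs)"
    by (rule last_in_set) simp
  then show ?thesis
    using assms by (auto simp: dyck_path_def set_ordinates_append last_ordinates)
qed

lemma hd_dyck_path:
  assumes "dyck_path P" "P \<noteq> []"
  shows "hd P = U"
proof (cases P)
  case (Cons s xs)
  then show ?thesis
    using assms net_rise_prefix_nonneg[of "[s]" xs] by (cases s) auto
qed (use assms in simp)

lemma last_dyck_path:
  assumes "dyck_path P" "P \<noteq> []"
  shows "last P = D"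
proof (cases "last P")
  case U
  have "net_rise (butlast P) + 1 = net_rise (butlast P @ [last P])"
    using U by simp
  also have "\<dots> = 0"
    using assms by (simp add: net_rise_dyck_path)
  finally show ?thesis
    using assms net_rise_prefix_nonneg[of "butlast P" "[last P]"] by simp
qed

lemma even_length_dyck_path:
  assumes "dyck_path P"
  shows "even (length P)"
proof -
  have "even (net_rise xs) \<longleftrightarrow> even (length xs)" for xs
  proof (induction xs)
    case (Cons s xs)
    then show ?case by (cases s) auto
  qed simp
  then show ?thesis
    using net_rise_dyck_path[OF assms] by (metis even_zero)
qed

abbreviation elevate :: "step list \<Rightarrow> step list" where
  "elevate \<alpha> \<equiv> U # \<alpha> @ [D]"

lemma dyck_path_first_return:
  assumes "dyck_path \<alpha>" "dyck_path \<beta>"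
  shows "dyck_path (elevate \<alpha> @ \<beta>)"
  using assms set_ordinates_shift[of 1 0 \<alpha>]
    net_rise_dyck_path[OF assms(1)] net_rise_dyck_path[OF assms(2)]
  by (auto simp: dyck_path_def set_ordinates_append last_ordinates)

lemma dyck_path_elevate: "dyck_path \<alpha> \<Longrightarrow> dyck_path (elevate \<alpha>)"
  using dyck_path_first_return[of \<alpha> "[]"] by simp

lemma dyck_path_extension_eq_Nil:
  assumes "dyck_path (xs @ us)" "dyck_path xs" "us @ D # ys = D # zs"
  shows "us = []"
proof (cases us)
  case (Cons s vs)
  then have "net_rise (xs @ [D]) \<ge> 0"
    using assms net_rise_prefix_nonneg[of "xs @ [D]" vs] by simp
  then show ?thesis
    using net_rise_dyck_path[OF assms(2)] by simp
qed

lemma dyck_path_append_D_inject: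
  assumes "dyck_path \<alpha>" "dyck_path \<alpha>'" and append_eq: "\<alpha> @ D # \<beta> = \<alpha>' @ D # \<beta>'"
  shows "\<alpha> = \<alpha>' \<and> \<beta> = \<beta>'"
proof -
  from append_eq consider us where "\<alpha> = \<alpha>' @ us" "us @ D # \<beta> = D # \<beta>'"
    | us where "\<alpha>' = \<alpha> @ us" "us @ D # \<beta>' = D # \<beta>"
    unfolding append_eq_append_conv2 by metis
  then have "\<alpha> = \<alpha>'"
    by cases (use assms dyck_path_extension_eq_Nil in fastforce)+
  with append_eq show ?thesis
    by simp
qed

lemma dyck_path_if_first_return_decomp: "first_return_decomp P \<alpha> \<beta> \<Longrightarrow> dyck_path P"
  using dyck_path_first_return[of \<alpha> \<beta>] by (simp add: first_return_decomp_def)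

lemma semilength_first_return_decomp:
  assumes "first_return_decomp P \<alpha> \<beta>"
  shows "semilength P = Suc (semilength \<alpha> + semilength \<beta>)"
  using assms even_length_dyck_path
  by (auto simp: first_return_decomp_def semilength_def elim!: evenE)

section \<open>Pattern heights\<close>

definition peak :: "step list \<Rightarrow> int" where
  "peak \<pi> = Max (set (ordinates 0 \<pi>))"

lemma Max_ordinates: "Max (set (ordinates a \<pi>)) = a + peak \<pi>"
  using mono_Max_commute[of "(+) a" "set (ordinates 0 \<pi>)"] set_ordinates_shift[of a 0 \<pi>]
  by (simp add: peak_def mono_def)

lemma occurrence_heights_eq:
  "occurrence_heights \<pi> P = {net_rise xs + peak \<pi> | xs ys. P = xs @ \<pi> @ ys}"
  by (simp add: occurrence_heights_def Max_ordinates last_ordinates)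

lemma occurrence_heights_eq_empty_iff: "occurrence_heights \<pi> P = {} \<longleftrightarrow> \<not> sublist \<pi> P"
  by (auto simp: occurrence_heights_eq sublist_def)

lemma occurrence_heights_Nil: "occurrence_heights \<pi> [] = (if \<pi> = [] then {peak \<pi>} else {})"
  by (auto simp: occurrence_heights_eq)

lemma occurrence_heights_Cons:
  "occurrence_heights \<pi> (s # P) =
     (if prefix \<pi> (s # P) then {peak \<pi>} else {}) \<union> (+) (rise s) ` occurrence_heights \<pi> P"
  (is "_ = ?start \<union> ?later")
proof (intro equalityI subsetI)
  fix h assume "h \<in> occurrence_heights \<pi> (s # P)"
  then obtain xs ys where P_eq: "s # P = xs @ \<pi> @ ys" and h_eq: "h = net_rise xs + peak \<pi>"
    by (auto simp: occurrence_heights_eq)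
  show "h \<in> ?start \<union> ?later"
  proof (cases xs)
    case Nil
    then show ?thesis
      using P_eq h_eq by simp
  next
    case (Cons s' xs')
    then have "net_rise xs' + peak \<pi> \<in> occurrence_heights \<pi> P"
      using P_eq by (auto simp: occurrence_heights_eq)
    then show ?thesis
      using Cons P_eq h_eq by auto
  qed
next
  fix h assume "h \<in> ?start \<union> ?later"
  then consider (start) ys where "s # P = \<pi> @ ys" "h = peak \<pi>"
    | (later) xs ys where "P = xs @ \<pi> @ ys" "h = rise s + (net_rise xs + peak \<pi>)"
    by (auto simp: occurrence_heights_eq prefix_def split: if_splits)
  then show "h \<in> occurrence_heights \<pi> (s # P)"
  proof cases
    case (start ys)
    then have "s # P = [] @ \<pi> @ ys" "h = net_rise [] + peak \<pi>"
      by simp_all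
    then show ?thesis
      unfolding occurrence_heights_eq by blast
  next
    case (later xs ys)
    then have "s # P = (s # xs) @ \<pi> @ ys" "h = net_rise (s # xs) + peak \<pi>"
      by simp_all
    then show ?thesis
      unfolding occurrence_heights_eq by blast
  qed
qed

lemma finite_occurrence_heights: "finite (occurrence_heights \<pi> P)"
  by (induction P) (simp_all add: occurrence_heights_Nil occurrence_heights_Cons)

lemma prefix_append_iff_if_last_notin_butlast:
  assumes "xs \<noteq> []" "last xs \<notin> set (butlast \<pi>)"
  shows "prefix \<pi> (xs @ ys) \<longleftrightarrow> prefix \<pi> xs"
proof
  assume "prefix \<pi> (xs @ ys)"
  then consider "prefix \<pi> xs" | (longer) zs where "\<pi> = xs @ zs"
    by (auto simp: prefix_append)
  then show "prefix \<pi> xs"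
  proof cases
    case (longer zs)
    then have "zs = []"
      using assms by (auto simp: butlast_append split: if_splits)
    with longer show ?thesis by simp
  qed
qed simp

lemma occurrence_heights_append:
  assumes "D \<notin> set (butlast \<pi>)" and "P \<noteq> [] \<Longrightarrow> last P = D"
  shows "occurrence_heights \<pi> (P @ Q) =
    occurrence_heights \<pi> P \<union> (+) (net_rise P) ` occurrence_heights \<pi> Q"
  using assms(2)
proof (induction P)
  case Nil
  then show ?case
    by (auto simp: occurrence_heights_eq intro: exI[of _ "[]"])
next
  case (Cons s P)
  have "P \<noteq> [] \<Longrightarrow> last P = D"
    using Cons.prems by simp
  then have "occurrence_heights \<pi> (P @ Q) =
      occurrence_heights \<pi> P \<union> (+) (net_rise P) ` occurrence_heights \<pi> Q"
    by (rule Cons.IH)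
  moreover have "prefix \<pi> (s # P @ Q) \<longleftrightarrow> prefix \<pi> (s # P)"
    using prefix_append_iff_if_last_notin_butlast[of "s # P" \<pi> Q] assms(1) Cons.prems by simp
  ultimately show ?case
    by (simp add: occurrence_heights_Cons image_Un image_image add.assoc Un_assoc)
qed

lemma occurrence_heights_append_dyck_path:
  assumes "D \<notin> set (butlast \<pi>)" "dyck_path P"
  shows "occurrence_heights \<pi> (P @ Q) = occurrence_heights \<pi> P \<union> occurrence_heights \<pi> Q"
  using assms by (simp add: occurrence_heights_append last_dyck_path net_rise_dyck_path)

lemma amplitude_eq: "amplitude \<pi> = peak \<pi> - Min (set (ordinates 0 \<pi>))"
  by (simp add: amplitude_def Max_ordinates)

lemma amplitude_nonneg: "amplitude \<pi> \<ge> 0"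
  by (simp add: amplitude_eq peak_def Max_ge_iff Min_le_iff)

lemma amplitude_le_occurrence_height:
  assumes "dyck_path P" "h \<in> occurrence_heights \<pi> P"
  shows "amplitude \<pi> \<le> h"
proof -
  obtain xs ys where P_eq: "P = xs @ \<pi> @ ys" and h_eq: "h = net_rise xs + peak \<pi>"
    using assms(2) by (auto simp: occurrence_heights_eq)
  have "set (ordinates (net_rise xs) \<pi>) \<subseteq> set (ordinates 0 P)"
    by (auto simp: P_eq set_ordinates_append)
  moreover have "net_rise xs + Min (set (ordinates 0 \<pi>)) \<in> set (ordinates (net_rise xs) \<pi>)"
    using set_ordinates_shift[of "net_rise xs" 0 \<pi>] by simp
  ultimately have "net_rise xs + Min (set (ordinates 0 \<pi>)) \<ge> 0"
    using assms(1) by (auto simp: dyck_path_def)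
  then show ?thesis
    unfolding amplitude_eq h_eq by linarith
qed

lemma pattern_height_eq_Max:
  assumes "dyck_path P"
  shows "pattern_height \<pi> P = Max (insert 0 (occurrence_heights \<pi> P))"
proof -
  have "h \<ge> 0" if "h \<in> occurrence_heights \<pi> P" for h
    using amplitude_nonneg amplitude_le_occurrence_height[OF assms that] by (rule order_trans)
  then show ?thesis
    by (auto simp: pattern_height_def finite_occurrence_heights Max_ge_iff max_def)
qed

lemma pattern_height_nonneg: "dyck_path P \<Longrightarrow> pattern_height \<pi> P \<ge> 0"
  by (simp add: pattern_height_eq_Max finite_occurrence_heights)

lemma pattern_height_eq_0_or_ge_amplitude:
  assumes "dyck_path P"
  shows "pattern_height \<pi> P = 0 \<or> pattern_height \<pi> P \<ge> amplitude \<pi>"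
  using amplitude_le_occurrence_height[OF assms] finite_occurrence_heights
  by (auto simp: pattern_height_def)

lemma pattern_height_Nil [simp]: "pattern_height \<pi> [] = 0"
  by (simp add: pattern_height_def occurrence_heights_Nil peak_def)

lemma pattern_height_append_dyck_path:
  assumes "D \<notin> set (butlast \<pi>)" "dyck_path P" "dyck_path Q" "dyck_path (P @ Q)"
  shows "pattern_height \<pi> (P @ Q) = max (pattern_height \<pi> P) (pattern_height \<pi> Q)"
proof -
  have "insert 0 (occurrence_heights \<pi> (P @ Q)) =
      insert 0 (occurrence_heights \<pi> P) \<union> insert 0 (occurrence_heights \<pi> Q)"
    using assms by (auto simp: occurrence_heights_append_dyck_path)
  then show ?thesis
    using assms
    by (simp add: pattern_height_eq_Max finite_occurrence_heights Max_Un
        del: Un_insert_left Un_insert_right)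
qed

lemma pattern_height_first_return_decomp:
  assumes "D \<notin> set (butlast \<pi>)" "first_return_decomp P \<alpha> \<beta>"
  shows "pattern_height \<pi> P = max (pattern_height \<pi> (elevate \<alpha>)) (pattern_height \<pi> \<beta>)"
  using assms dyck_path_if_first_return_decomp[OF assms(2)]
    pattern_height_append_dyck_path[of \<pi> "elevate \<alpha>" \<beta>]
  by (simp add: first_return_decomp_def dyck_path_elevate)

section \<open>First return decompositions by height\<close>

lemma dyck_path_dyck_geq: "P \<in> dyck_geq \<pi> \<Longrightarrow> dyck_path P"
  by (erule dyck_geq.cases) auto

definition height_class :: "step list \<Rightarrow> nat \<Rightarrow> step list set" where
  "height_class \<pi> k = {P \<in> dyck_geq \<pi>. pattern_height \<pi> P = int k}"

definition first_return_product :: "step list set \<Rightarrow> step list set \<Rightarrow> step list set" where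
  "first_return_product S T = {P. \<exists>\<alpha>\<in>S. \<exists>\<beta>\<in>T. first_return_decomp P \<alpha> \<beta>}"

lemma UN_height_class: "(\<Union>j\<le>k. height_class \<pi> j) = {P \<in> dyck_geq \<pi>. pattern_height \<pi> P \<le> int k}"
proof -
  have "\<exists>j\<le>k. pattern_height \<pi> P = int j"
    if "P \<in> dyck_geq \<pi>" "pattern_height \<pi> P \<le> int k" for P
    using that pattern_height_nonneg[OF dyck_path_dyck_geq]
    by (intro exI[of _ "nat (pattern_height \<pi> P)"]) auto
  then show ?thesis
    by (auto simp: height_class_def)
qed

lemma height_class_first_return:
  assumes "D \<notin> set (butlast \<pi>)"
  shows "height_class \<pi> k = (if k = 0 then {[]} else {}) \<union>
    first_return_product {\<alpha> \<in> dyck_geq \<pi>. pattern_height \<pi> (elevate \<alpha>) = int k}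
      (\<Union>j\<le>k. height_class \<pi> j)"
  (is "_ = ?empty \<union> first_return_product ?S ?T")
proof (intro equalityI subsetI)
  fix P assume "P \<in> height_class \<pi> k"
  then have "P \<in> dyck_geq \<pi>" and height: "pattern_height \<pi> P = int k"
    by (auto simp: height_class_def)
  then show "P \<in> ?empty \<union> first_return_product ?S ?T"
  proof cases
    case empty
    then show ?thesis
      using height by simp
  next
    case (decomp \<alpha> \<beta>)
    then have "\<alpha> \<in> ?S" "\<beta> \<in> ?T"
      using height pattern_height_first_return_decomp[OF assms decomp(2)]
      by (auto simp: UN_height_class)
    then show ?thesis
      using decomp(2) by (auto simp: first_return_product_def)
  qed
next
  fix P assume "P \<in> ?empty \<union> first_return_product ?S ?T"
  then consider (empty) "k = 0" "P = []"
    | (decomp) \<alpha> \<beta> where "\<alpha> \<in> ?S" "\<beta> \<in> ?T" "first_return_decomp P \<alpha> \<beta>"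
    by (auto simp: first_return_product_def split: if_splits)
  then show "P \<in> height_class \<pi> k"
  proof cases
    case empty
    then show ?thesis
      by (simp add: height_class_def dyck_geq.empty)
  next
    case (decomp \<alpha> \<beta>)
    then have "P \<in> dyck_geq \<pi>"
      using dyck_path_if_first_return_decomp
      by (intro dyck_geq.decomp[of P \<alpha> \<beta>]) (auto simp: UN_height_class)
    then show ?thesis
      using decomp pattern_height_first_return_decomp[OF assms decomp(3)]
      by (auto simp: height_class_def UN_height_class)
  qed
qed

section \<open>Generating functions by semilength\<close>

lemma fps_eq_divideI:
  fixes a b c :: "'a::field fps"
  assumes "a * b = c" "fps_nth b 0 \<noteq> 0"
  shows "a = c / b"
proof -
  have "b \<noteq> 0"
    using assms(2) by auto
  then show ?thesis
    using assms(1) by auto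
qed

definition semilength_gf :: "step list set \<Rightarrow> rat fps" where
  "semilength_gf S = Abs_fps (\<lambda>n. of_nat (card {P \<in> S. semilength P = n}))"

lemma finite_semilength: "finite {P \<in> S. semilength P = n}"
proof (rule finite_subset)
  have "s \<in> {U, D}" for s
    by (cases s) auto
  then show "{P \<in> S. semilength P = n} \<subseteq> {P. set P \<subseteq> {U, D} \<and> length P \<le> 2 * n + 1}"
    by (auto simp: semilength_def)
  show "finite {P. set P \<subseteq> {U, D} \<and> length P \<le> 2 * n + 1}"
    by (rule finite_lists_length_le) simp
qed

lemma semilength_gf_empty [simp]: "semilength_gf {} = 0"
  by (simp add: semilength_gf_def fps_eq_iff)

lemma semilength_gf_Nil [simp]: "semilength_gf {[]} = 1"
proof (rule fps_ext)
  fix n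
  have "{P \<in> {[]}. semilength P = n} = (if n = 0 then {[]} else {})"
    by (auto simp: semilength_def)
  then show "fps_nth (semilength_gf {[]}) n = fps_nth 1 n"
    by (simp add: semilength_gf_def)
qed

lemma semilength_gf_Un_disjoint:
  assumes "S \<inter> T = {}"
  shows "semilength_gf (S \<union> T) = semilength_gf S + semilength_gf T"
proof (rule fps_ext)
  fix n
  have "{P \<in> S \<union> T. semilength P = n} = {P \<in> S. semilength P = n} \<union> {P \<in> T. semilength P = n}"
    by auto
  then show "fps_nth (semilength_gf (S \<union> T)) n = fps_nth (semilength_gf S + semilength_gf T) n"
    using assms by (simp add: semilength_gf_def card_Un_disjoint finite_semilength disjoint_iff)
qed

lemma semilength_gf_Diff:
  assumes "T \<subseteq> S"
  shows "semilength_gf (S - T) = semilength_gf S - semilength_gf T"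
proof -
  have "S = (S - T) \<union> T"
    using assms by blast
  then have "semilength_gf S = semilength_gf (S - T) + semilength_gf T"
    using semilength_gf_Un_disjoint[of "S - T" T] by (metis Diff_disjoint Int_commute)
  then show ?thesis
    by simp
qed

lemma semilength_gf_UN_disjoint:
  assumes "finite I" "disjoint_family_on S I"
  shows "semilength_gf (\<Union>i\<in>I. S i) = (\<Sum>i\<in>I. semilength_gf (S i))"
  using assms
proof (induction I rule: finite_induct)
  case (insert i I)
  then have "S i \<inter> (\<Union>j\<in>I. S j) = {}" and "disjoint_family_on S I"
    by (auto simp: disjoint_family_on_def)
  with insert show ?case
    by (simp add: semilength_gf_Un_disjoint)
qed simp

lemma first_return_product_eq_image:
  assumes "S \<subseteq> Collect dyck_path" "T \<subseteq> Collect dyck_path"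
  shows "first_return_product S T = (\<lambda>(\<alpha>, \<beta>). elevate \<alpha> @ \<beta>) ` (S \<times> T)"
  using assms by (fastforce simp: first_return_product_def first_return_decomp_def image_iff)

lemma inj_on_first_return:
  "inj_on (\<lambda>(\<alpha>, \<beta>). elevate \<alpha> @ \<beta>) (Collect dyck_path \<times> Collect dyck_path)"
  by (rule inj_onI) (auto dest: dyck_path_append_D_inject)

lemma card_first_return_product:
  assumes "S \<subseteq> Collect dyck_path" "T \<subseteq> Collect dyck_path"
  shows "card {P \<in> first_return_product S T. semilength P = Suc n} =
    (\<Sum>i=0..n. card {\<alpha> \<in> S. semilength \<alpha> = i} * card {\<beta> \<in> T. semilength \<beta> = n - i})"
proof -
  let ?pairs = "\<lambda>i. {\<alpha> \<in> S. semilength \<alpha> = i} \<times> {\<beta> \<in> T. semilength \<beta> = n - i}"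
  have semilength: "semilength (elevate \<alpha> @ \<beta>) = Suc (semilength \<alpha> + semilength \<beta>)"
    if "\<alpha> \<in> S" "\<beta> \<in> T" for \<alpha> \<beta>
    using that assms
    by (intro semilength_first_return_decomp) (auto simp: first_return_decomp_def)
  have "{P \<in> first_return_product S T. semilength P = Suc n} =
      (\<lambda>(\<alpha>, \<beta>). elevate \<alpha> @ \<beta>) ` (\<Union>i\<in>{0..n}. ?pairs i)"
    unfolding first_return_product_eq_image[OF assms] using semilength by fastforce
  moreover have "inj_on (\<lambda>(\<alpha>, \<beta>). elevate \<alpha> @ \<beta>) (\<Union>i\<in>{0..n}. ?pairs i)"
    by (rule inj_on_subset[OF inj_on_first_return]) (use assms in auto)
  ultimately have "card {P \<in> first_return_product S T. semilength P = Suc n} =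
      card (\<Union>i\<in>{0..n}. ?pairs i)"
    by (simp only: card_image)
  also have "\<dots> = (\<Sum>i=0..n. card (?pairs i))"
    by (rule card_UN_disjoint) (auto simp: finite_semilength)
  finally show ?thesis
    by (simp add: card_cartesian_product)
qed

lemma semilength_gf_first_return_product:
  assumes "S \<subseteq> Collect dyck_path" "T \<subseteq> Collect dyck_path"
  shows "semilength_gf (first_return_product S T) = fps_X * (semilength_gf S * semilength_gf T)"
proof (rule fps_ext)
  fix n
  show "fps_nth (semilength_gf (first_return_product S T)) n =
    fps_nth (fps_X * (semilength_gf S * semilength_gf T)) n"
  proof (cases n)
    case 0
    have no_empty_path: "{P \<in> first_return_product S T. semilength P = 0} = {}"
      by (auto simp: first_return_product_def semilength_first_return_decomp)
    show ?thesis
      by (simp add: 0 semilength_gf_def no_empty_path)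
  next
    case (Suc m)
    then show ?thesis
      using assms fps_mult_nth[of "semilength_gf S" "semilength_gf T" m]
      by (simp add: semilength_gf_def card_first_return_product)
  qed
qed

lemma height_gf_eq_semilength_gf: "height_gf \<pi> k = semilength_gf (height_class \<pi> k)"
  by (simp add: height_gf_def semilength_gf_def height_class_def)

lemma height_gf_eq_0:
  assumes "0 < k" "int k < amplitude \<pi>"
  shows "height_gf \<pi> k = 0"
proof -
  have "pattern_height \<pi> P \<noteq> int k" if "P \<in> dyck_geq \<pi>" for P
    using assms pattern_height_eq_0_or_ge_amplitude[OF dyck_path_dyck_geq[OF that], of \<pi>] by auto
  then have "height_class \<pi> k = {}"
    by (auto simp: height_class_def)
  then show ?thesis
    by (simp add: height_gf_eq_semilength_gf)
qed

lemma height_gf_functional_equation: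
  assumes "D \<notin> set (butlast \<pi>)"
  shows "height_gf \<pi> k = (if k = 0 then 1 else 0) +
    fps_X * (semilength_gf {\<alpha> \<in> dyck_geq \<pi>. pattern_height \<pi> (elevate \<alpha>) = int k} *
      (\<Sum>j\<le>k. height_gf \<pi> j))"
proof -
  let ?S = "{\<alpha> \<in> dyck_geq \<pi>. pattern_height \<pi> (elevate \<alpha>) = int k}"
  let ?T = "\<Union>j\<le>k. height_class \<pi> j"
  have "(if k = 0 then {[]} else {}) \<inter> first_return_product ?S ?T = {}"
    by (auto simp: first_return_product_def first_return_decomp_def split: if_splits)
  then have "height_gf \<pi> k =
      semilength_gf (if k = 0 then {[]} else {}) + semilength_gf (first_return_product ?S ?T)"
    unfolding height_gf_eq_semilength_gf height_class_first_return[OF assms, of k]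
    by (rule semilength_gf_Un_disjoint)
  also have "semilength_gf (first_return_product ?S ?T) =
      fps_X * (semilength_gf ?S * semilength_gf ?T)"
    by (rule semilength_gf_first_return_product) (auto simp: height_class_def dyck_path_dyck_geq)
  also have "semilength_gf ?T = (\<Sum>j\<le>k. height_gf \<pi> j)"
    unfolding height_gf_eq_semilength_gf
    by (rule semilength_gf_UN_disjoint) (auto simp: disjoint_family_on_def height_class_def)
  finally show ?thesis
    by simp
qed

section \<open>The pattern \<open>UUD\<close>\<close>

abbreviation UUD :: "step list" where
  "UUD \<equiv> [U, U, D]"

lemma amplitude_UUD: "amplitude UUD = 2"
  by (simp add: amplitude_def)

lemma sublist_UUD_Cons_U_U: "D \<in> set xs \<Longrightarrow> sublist UUD (U # U # xs)"
proof (induction xs)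
  case (Cons s xs)
  then show ?case by (cases s) (auto simp: sublist_Cons_right)
qed simp

lemma occurrence_heights_UUD_elevate_nonempty:
  assumes "dyck_path \<alpha>" "\<alpha> \<noteq> []"
  shows "occurrence_heights UUD (elevate \<alpha>) \<noteq> {}"
proof -
  obtain \<gamma> where "\<alpha> = U # \<gamma>"
    using hd_dyck_path[OF assms] assms(2) by (cases \<alpha>) auto
  then show ?thesis
    using sublist_UUD_Cons_U_U[of "\<gamma> @ [D]"] by (simp add: occurrence_heights_eq_empty_iff)
qed

lemma occurrence_heights_UUD_elevate:
  assumes "dyck_path \<alpha>"
  shows "occurrence_heights UUD (elevate \<alpha>) =
    (if prefix UUD (elevate \<alpha>) then {2} else {}) \<union> (+) 1 ` occurrence_heights UUD \<alpha>"
proof -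
  have "occurrence_heights UUD [D] = {}"
    by (simp add: occurrence_heights_eq_empty_iff sublist_Cons_right)
  then have "occurrence_heights UUD (\<alpha> @ [D]) = occurrence_heights UUD \<alpha>"
    using assms by (simp add: occurrence_heights_append_dyck_path)
  then show ?thesis
    using occurrence_heights_Cons[of UUD U "\<alpha> @ [D]"] by (simp add: peak_def)
qed

lemma pattern_height_UUD_elevate:
  assumes "dyck_path \<alpha>"
  shows "pattern_height UUD (elevate \<alpha>) =
    (if \<alpha> = [] then 0 else max 2 (pattern_height UUD \<alpha> + 1))"
proof (cases "\<alpha> = []")
  case True
  then show ?thesis
    by (simp add: pattern_height_def occurrence_heights_eq_empty_iff sublist_Cons_right)
next
  case nonempty: False
  note elevate = occurrence_heights_UUD_elevate[OF assms]
  show ?thesis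
  proof (cases "occurrence_heights UUD \<alpha> = {}")
    case True
    then have "occurrence_heights UUD (elevate \<alpha>) = {2}"
      using elevate occurrence_heights_UUD_elevate_nonempty[OF assms nonempty]
      by (auto split: if_splits)
    then show ?thesis
      using True nonempty by (simp add: pattern_height_def)
  next
    case False
    then have "pattern_height UUD \<alpha> \<in> occurrence_heights UUD \<alpha>"
      by (simp add: pattern_height_def finite_occurrence_heights)
    then have "pattern_height UUD \<alpha> \<ge> 2"
      using amplitude_le_occurrence_height[OF assms] amplitude_UUD by fastforce
    moreover have "Max ((+) 1 ` occurrence_heights UUD \<alpha>) = 1 + pattern_height UUD \<alpha>"
      using False mono_Max_commute[of "(+) 1" "occurrence_heights UUD \<alpha>"]
      by (simp add: pattern_height_def finite_occurrence_heights mono_def)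
    ultimately show ?thesis
      using False nonempty elevate finite_occurrence_heights[of UUD \<alpha>]
      by (simp add: pattern_height_def Max_Un)
  qed
qed

lemma pattern_height_UUD_elevate_eq_0_iff:
  "dyck_path \<alpha> \<Longrightarrow> pattern_height UUD (elevate \<alpha>) = 0 \<longleftrightarrow> \<alpha> = []"
  by (auto simp: pattern_height_UUD_elevate max_def)

lemma pattern_height_UUD_elevate_eq_2_iff:
  "dyck_path \<alpha> \<Longrightarrow>
    pattern_height UUD (elevate \<alpha>) = 2 \<longleftrightarrow> \<alpha> \<noteq> [] \<and> pattern_height UUD \<alpha> = 0"
  using pattern_height_eq_0_or_ge_amplitude[of \<alpha> UUD] amplitude_UUD
  by (auto simp: pattern_height_UUD_elevate)

lemma height_gf_UUD_0: "height_gf UUD 0 = 1 / (1 - fps_X)"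
proof (rule fps_eq_divideI)
  have "{\<alpha> \<in> dyck_geq UUD. pattern_height UUD (elevate \<alpha>) = 0} = {[]}"
    using pattern_height_UUD_elevate_eq_0_iff dyck_path_dyck_geq by (auto intro: dyck_geq.empty)
  then have "height_gf UUD 0 = 1 + fps_X * height_gf UUD 0"
    by (intro trans[OF height_gf_functional_equation]) simp_all
  then show "height_gf UUD 0 * (1 - fps_X) = 1"
    by algebra
qed simp

lemma height_gf_UUD_1: "height_gf UUD 1 = 0"
  by (rule height_gf_eq_0) (simp_all add: amplitude_UUD)

lemma semilength_gf_UUD_elevate_2:
  "semilength_gf {\<alpha> \<in> dyck_geq UUD. pattern_height UUD (elevate \<alpha>) = 2} = height_gf UUD 0 - 1"
  (is "semilength_gf ?S = _")
proof -
  have "\<alpha> \<in> ?S \<longleftrightarrow> \<alpha> \<in> height_class UUD 0 - {[]}" for \<alpha>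
    using pattern_height_UUD_elevate_eq_2_iff[of \<alpha>] dyck_path_dyck_geq[of \<alpha> UUD]
    by (auto simp: height_class_def)
  then have S_eq: "?S = height_class UUD 0 - {[]}"
    by blast
  have "{[]} \<subseteq> height_class UUD 0"
    by (simp add: height_class_def dyck_geq.empty)
  then show ?thesis
    unfolding S_eq by (simp add: semilength_gf_Diff height_gf_eq_semilength_gf)
qed

lemma height_gf_UUD_2:
  "height_gf UUD 2 = fps_X ^ 2 / ((fps_X - 1) * (fps_X ^ 2 + fps_X - 1))"
proof (rule fps_eq_divideI)
  have sum_eq: "(\<Sum>j\<le>2. height_gf UUD j) = height_gf UUD 0 + height_gf UUD 2"
    using height_gf_UUD_1 by (simp add: numeral_2_eq_2)
  have "height_gf UUD 2 =
      fps_X * ((height_gf UUD 0 - 1) * (height_gf UUD 0 + height_gf UUD 2))"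
    by (rule trans[OF height_gf_functional_equation])
      (simp_all add: semilength_gf_UUD_elevate_2 sum_eq)
  moreover have "height_gf UUD 0 * (1 - fps_X) = 1"
    by (simp add: height_gf_UUD_0)
  ultimately show "height_gf UUD 2 * ((fps_X - 1) * (fps_X ^ 2 + fps_X - 1)) = fps_X ^ 2"
    by algebra
qed simp

theorem theorem2:
  fixes \<pi> :: "step list" and A :: "nat \<Rightarrow> rat fps"
  assumes "\<pi> = [U, U, D]"
    and "\<And>k. A k = height_gf \<pi> k"
  shows "amplitude \<pi> = 2
    \<and> A 2 = fps_X ^ 2 / ((fps_X - 1) * (fps_X ^ 2 + fps_X - 1))
    \<and> A 1 = 0
    \<and> A 0 = 1 / (1 - fps_X)"
  using assms amplitude_UUD height_gf_UUD_2 height_gf_UUD_1 height_gf_UUD_0 by simp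

end
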